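(* Let $d\ge 2$ be an integer and $D=\binom{d}{2}$. The space of unlabeled graphs $\mathcal{U}_d=\mathcal{G}_d/\Sigma_d=\mathcal{O}_D/\Sigma_d$, with the quotient topology, is a stratified space.
   Context: A labeled network (graph) on $d$ vertices is an undirected graph on vertex set $\{1,\dots,d\}$ with nonnegative edge weights (zero weights allowed). Ordering the $D=\binom d2$ edges $\{(i,j):1\le i<j\le d\}$ lexicographically, the set $\mathcal{G}_d$ of all labeled networks is identified with $\mathcal{O}_D=\{\vec x=(x^1,\dots,x^D)\in\mathbb{R}^D: x^i\ge 0\}$ via the vector of edge weights, with the standard Euclidean topology. The group $\Sigma_d$ of permutations of $\{1,\dots,d\}$ acts on $\mathcal{G}_d$ by $(\sigma\cdot w)(i,j)=w(\sigma^{-1}(i),\sigma^{-1}(j))$, where $w$ is the symmetric weight function; equivalently it acts on $\mathcal{O}_D$ by the induced permutation of the $D$ edges. The space of unlabeled networks is $\mathcal{U}_d=\mathcal{O}_D/\Sigma_d$. A stratified space is a (Hausdorff, second countable) topological space together with a locally finite partition into locally closed subsets (strata), each of which is a topological manifold (without boundary) in the subspace topology, such that if a stratum $S$ meets the closure of a stratum $T$ then $S\subset\overline{T}$. *)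

theory Defs
  imports
    "HOL-Analysis.Analysis"
    "HOL-Algebra.Group_Action"
    "HOL-Algebra.Sym_Groups"
begin

no_notation eq_closure_of (\<open>closure'_of\<index>\<close>)

section \<open>Quotient topology\<close>

definition quotient_topology :: "'a topology \<Rightarrow> ('a \<Rightarrow> 'b) \<Rightarrow> 'b topology" where
  "quotient_topology X q =
     topology (\<lambda>U. U \<subseteq> q ` topspace X \<and> openin X {x \<in> topspace X. q x \<in> U})"

lemma openin_quotient_topology:
  "openin (quotient_topology X q) U \<longleftrightarrow>
     U \<subseteq> q ` topspace X \<and> openin X {x \<in> topspace X. q x \<in> U}"
proof -
  have int: "{x \<in> topspace X. q x \<in> S \<inter> T} = {x \<in> topspace X. q x \<in> S} \<inter> {x \<in> topspace X. q x \<in> T}"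
    for S T by auto
  have un: "{x \<in> topspace X. q x \<in> \<Union>K} = (\<Union>S\<in>K. {x \<in> topspace X. q x \<in> S})"
    for K by auto
  have "istopology (\<lambda>U. U \<subseteq> q ` topspace X \<and> openin X {x \<in> topspace X. q x \<in> U})"
    unfolding istopology_def by (auto simp only: int un intro!: openin_Int openin_Union)
  then show ?thesis
    unfolding quotient_topology_def by (simp add: topology_inverse')
qed

lemma topspace_quotient_topology: "topspace (quotient_topology X q) = q ` topspace X"
proof -
  have "{x \<in> topspace X. q x \<in> q ` topspace X} = topspace X" by auto
  then have "openin (quotient_topology X q) (q ` topspace X)"
    by (simp add: openin_quotient_topology)
  moreover have "openin (quotient_topology X q) (topspace (quotient_topology X q))"
    by simp
  ultimately show ?thesis
    by (meson openin_quotient_topology openin_subset subset_antisym)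
qed

lemma quotient_map_quotient_topology: "quotient_map X (quotient_topology X q) q"
  by (auto simp: quotient_map_def topspace_quotient_topology openin_quotient_topology)


section \<open>Stratified spaces\<close>

definition locally_closed_in :: "'a topology \<Rightarrow> 'a set \<Rightarrow> bool" where
  "locally_closed_in X S \<longleftrightarrow> (\<exists>U C. openin X U \<and> closedin X C \<and> S = U \<inter> C)"

definition topological_manifold :: "nat \<Rightarrow> 'a topology \<Rightarrow> bool" where
  "topological_manifold n X \<longleftrightarrow>
     Hausdorff_space X \<and> second_countable X \<and>
     (\<forall>x \<in> topspace X. \<exists>U V. openin X U \<and> x \<in> U \<and> openin (Euclidean_space n) V \<and>
        subtopology X U homeomorphic_space subtopology (Euclidean_space n) V)"

text \<open>Each stratum has one dimension, which may differ from stratum to stratum.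
  Strata are nonempty, since \<^const>\<open>partition_on\<close> excludes empty blocks.\<close>

definition stratification :: "'a topology \<Rightarrow> 'a set set \<Rightarrow> bool" where
  "stratification X \<S> \<longleftrightarrow>
     partition_on (topspace X) \<S> \<and>
     locally_finite_in X \<S> \<and>
     (\<forall>S \<in> \<S>. locally_closed_in X S \<and> (\<exists>n. topological_manifold n (subtopology X S))) \<and>
     (\<forall>S \<in> \<S>. \<forall>T \<in> \<S>. S \<inter> X closure_of T \<noteq> {} \<longrightarrow> S \<subseteq> X closure_of T)"

definition stratified_space :: "'a topology \<Rightarrow> bool" where
  "stratified_space X \<longleftrightarrow>
     Hausdorff_space X \<and> second_countable X \<and> (\<exists>\<S>. stratification X \<S>)"


section \<open>Labeled networks and the nonnegative orthant\<close>

text \<open>A labeled network is given by its symmetric weight function, extended by \<open>0\<close> outside of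
  the pairs of distinct vertices in \<open>{1..d}\<close> so that it is determined by its edge weights.\<close>

definition networks :: "nat \<Rightarrow> (nat \<Rightarrow> nat \<Rightarrow> real) set" where
  "networks d = {w. (\<forall>i j. w i j = w j i) \<and> (\<forall>i j. 0 \<le> w i j) \<and>
                    (\<forall>i j. \<not> (i \<in> {1..d} \<and> j \<in> {1..d} \<and> i \<noteq> j) \<longrightarrow> w i j = 0)}"

definition network_action :: "nat \<Rightarrow> (nat \<Rightarrow> nat) \<Rightarrow> (nat \<Rightarrow> nat \<Rightarrow> real) \<Rightarrow> (nat \<Rightarrow> nat \<Rightarrow> real)" where
  "network_action d \<sigma> = (\<lambda>w \<in> networks d. \<lambda>i j. w (inv' \<sigma> i) (inv' \<sigma> j))"

text \<open>The edges \<open>(i, j)\<close>, \<open>1 \<le> i < j \<le> d\<close>, in lexicographic order.\<close>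

definition edge_list :: "nat \<Rightarrow> (nat \<times> nat) list" where
  "edge_list d = [(i, j). i \<leftarrow> [1..<Suc d], j \<leftarrow> [Suc i..<Suc d]]"

text \<open>Coordinates are numbered from \<open>0\<close>; a point of \<^term>\<open>Euclidean_space n\<close> is a sequence
  vanishing from index \<open>n\<close> on.\<close>

definition edge_weights :: "nat \<Rightarrow> (nat \<Rightarrow> nat \<Rightarrow> real) \<Rightarrow> nat \<Rightarrow> real" where
  "edge_weights d w = (\<lambda>k. if k < d choose 2 then case edge_list d ! k of (i, j) \<Rightarrow> w i j else 0)"

definition orthant :: "nat \<Rightarrow> (nat \<Rightarrow> real) set" where
  "orthant n = {x \<in> topspace (Euclidean_space n). \<forall>k<n. 0 \<le> x k}"

definition network_topology :: "nat \<Rightarrow> (nat \<Rightarrow> nat \<Rightarrow> real) topology" where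
  "network_topology d = pullback_topology (networks d) (edge_weights d) (Euclidean_space (d choose 2))"

definition orthant_topology :: "nat \<Rightarrow> (nat \<Rightarrow> real) topology" where
  "orthant_topology n = subtopology (Euclidean_space n) (orthant n)"

text \<open>The action on the orthant is the action on networks transported along
  \<^const>\<open>edge_weights\<close>, which is a bijection by \<open>bij_betw_edge_weights\<close> below.\<close>

definition edge_action :: "nat \<Rightarrow> (nat \<Rightarrow> nat) \<Rightarrow> (nat \<Rightarrow> real) \<Rightarrow> (nat \<Rightarrow> real)" where
  "edge_action d \<sigma> = (\<lambda>x \<in> orthant (d choose 2).
     edge_weights d (network_action d \<sigma> (inv_into (networks d) (edge_weights d) x)))"

definition unlabeled_networks :: "nat \<Rightarrow> (nat \<Rightarrow> real) set topology" where
  "unlabeled_networks d =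
     quotient_topology (orthant_topology (d choose 2)) (orbit (sym_group d) (edge_action d))"


section \<open>The identification of networks with edge weight vectors\<close>

lemma set_edge_list: "set (edge_list d) = {(i, j). 1 \<le> i \<and> i < j \<and> j \<le> d}"
  by (force simp: edge_list_def)

lemma sorted_edge_list:
  "sorted_wrt (\<lambda>(i, j) (i', j'). i < i' \<or> i = i' \<and> j < j') (edge_list d)"
proof -
  have row: "sorted_wrt (\<lambda>(i, j) (i', j'). i < i' \<or> i = i' \<and> j < j') (map (Pair (i::nat)) xs)"
    if "sorted_wrt (<) xs" for i and xs :: "nat list"
    using that by (simp add: sorted_wrt_map)
  have "sorted_wrt (\<lambda>(i, j) (i', j'). i < i' \<or> i = i' \<and> j < j')
          (concat (map (\<lambda>i. map (Pair i) (f i)) is))"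
    if "sorted_wrt (<) is" "\<And>i. sorted_wrt (<) (f i)" for "is" :: "nat list" and f :: "nat \<Rightarrow> nat list"
    using that by (induction "is") (auto simp: sorted_wrt_append row)
  then show ?thesis
    by (simp add: edge_list_def sorted_wrt_upt del: upt_Suc)
qed

lemma distinct_edge_list: "distinct (edge_list d)"
proof -
  have "edge_list d ! k \<noteq> edge_list d ! l" if "k < l" "l < length (edge_list d)" for k l
    using sorted_wrt_nth_less[OF sorted_edge_list that] by auto
  then show ?thesis
    by (metis distinct_conv_nth nat_neq_iff)
qed

lemma length_edge_list: "length (edge_list d) = d choose 2"
proof -
  have 1: "length (edge_list d) = (\<Sum>i\<leftarrow>[1..<Suc d]. d - i)"
    by (simp add: edge_list_def length_concat o_def del: upt_Suc)
  have "(\<Sum>i\<leftarrow>[1..<Suc d]. d - i) = (\<Sum>i\<in>{1..<Suc d}. d - i)"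
    by (simp only: interv_sum_list_conv_sum_set_nat set_upt)
  also have "\<dots> = (\<Sum>i<d. i)"
    by (rule sum.reindex_bij_witness[of _ "\<lambda>i. d - i" "\<lambda>i. d - i"]) auto
  also have "\<dots> = d choose 2"
    by (induction d) (auto simp: numeral_2_eq_2)
  finally show ?thesis using 1 by simp
qed

lemma edge_list_nth_exists:
  assumes "1 \<le> i" "i < j" "j \<le> d"
  shows "\<exists>k < d choose 2. edge_list d ! k = (i, j)"
proof -
  have "(i, j) \<in> set (edge_list d)"
    using assms by (simp add: set_edge_list)
  then show ?thesis
    by (simp add: in_set_conv_nth length_edge_list)
qed

lemma edge_list_nth:
  assumes "k < d choose 2" "edge_list d ! k = (i, j)"
  shows "1 \<le> i" "i < j" "j \<le> d"
proof -
  have "(i, j) \<in> set (edge_list d)"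
    using assms by (metis nth_mem length_edge_list)
  then show "1 \<le> i" "i < j" "j \<le> d"
    by (simp_all add: set_edge_list)
qed

lemma bij_betw_edge_weights: "bij_betw (edge_weights d) (networks d) (orthant (d choose 2))"
  unfolding bij_betw_def
proof
  show "inj_on (edge_weights d) (networks d)"
  proof (rule inj_onI)
    fix v w assume v: "v \<in> networks d" and w: "w \<in> networks d"
      and eq: "edge_weights d v = edge_weights d w"
    have less: "v i j = w i j" if b: "1 \<le> i" "i < j" "j \<le> d" for i j
    proof -
      obtain k where "k < d choose 2" "edge_list d ! k = (i, j)"
        using edge_list_nth_exists[OF b] by blast
      then show ?thesis
        using fun_cong[OF eq, of k] by (simp add: edge_weights_def)
    qed
    have "v i j = w i j" for i j
    proof (cases "i \<in> {1..d} \<and> j \<in> {1..d} \<and> i \<noteq> j")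
      case True
      then consider "i < j" | "j < i" by linarith
      then show ?thesis
      proof cases
        case 1 then show ?thesis using True less by simp
      next
        case 2
        then have "v j i = w j i" using True less by simp
        moreover have "v i j = v j i" "w i j = w j i" using v w by (auto simp: networks_def)
        ultimately show ?thesis by simp
      qed
    next
      case False
      then have "v i j = 0" "w i j = 0" using v w unfolding networks_def by blast+
      then show ?thesis by simp
    qed
    then show "v = w" by blast
  qed
  show "edge_weights d ` networks d = orthant (d choose 2)"
  proof
    show "edge_weights d ` networks d \<subseteq> orthant (d choose 2)"
      by (auto simp: edge_weights_def networks_def orthant_def topspace_Euclidean_space split: prod.split)
    show "orthant (d choose 2) \<subseteq> edge_weights d ` networks d"
    proof
      fix x assume x: "x \<in> orthant (d choose 2)"
      define e where "e i j = (THE k. k < d choose 2 \<and> edge_list d ! k = (min i j, max i j))" for i j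
      have e_nth: "e i j = k" if "k < d choose 2" "edge_list d ! k = (min i j, max i j)" for i j k
        unfolding e_def using that distinct_edge_list[of d]
        by (intro the_equality) (auto, metis nth_eq_iff_index_eq length_edge_list)
      define w where "w i j = (if i \<in> {1..d} \<and> j \<in> {1..d} \<and> i \<noteq> j then x (e i j) else 0)" for i j
      have "0 \<le> w i j" for i j
      proof (cases "i \<in> {1..d} \<and> j \<in> {1..d} \<and> i \<noteq> j")
        case True
        then have "1 \<le> min i j" "min i j < max i j" "max i j \<le> d" by auto
        then obtain k where k: "k < d choose 2" "edge_list d ! k = (min i j, max i j)"
          using edge_list_nth_exists by blast
        then show ?thesis
          using x e_nth[OF k] True by (simp add: w_def orthant_def)
      qed (auto simp: w_def)
      moreover have "e i j = e j i" for i j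
        by (simp add: e_def min.commute max.commute)
      ultimately have "w \<in> networks d"
        by (auto simp: networks_def w_def)
      moreover have "edge_weights d w = x"
      proof
        fix k
        show "edge_weights d w k = x k"
        proof (cases "k < d choose 2")
          case True
          obtain i j where ij: "edge_list d ! k = (i, j)" by fastforce
          note b = edge_list_nth[OF True ij]
          then have "e i j = k"
            using e_nth[OF True, of i j] ij by (simp add: min_def max_def)
          then show ?thesis using True ij b by (simp add: edge_weights_def w_def)
        next
          case False
          then show ?thesis using x by (simp add: edge_weights_def orthant_def topspace_Euclidean_space)
        qed
      qed
      ultimately show "x \<in> edge_weights d ` networks d" by blast
    qed
  qed
qed

lemma network_action_closed:
  assumes "\<sigma> \<in> carrier (sym_group d)" "w \<in> networks d"
  shows "network_action d \<sigma> w \<in> networks d"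
proof -
  have p: "inv' \<sigma> permutes {1..d}"
    using assms(1) by (simp add: sym_group_carrier permutes_inv)
  have "inv' \<sigma> i \<in> {1..d} \<longleftrightarrow> i \<in> {1..d}" for i
    using permutes_in_image[OF p] .
  moreover have "inv' \<sigma> i = inv' \<sigma> j \<longleftrightarrow> i = j" for i j
    using permutes_inj[OF p] by (simp add: inj_eq)
  ultimately show ?thesis
    using assms(2) by (simp add: network_action_def networks_def del: atLeastAtMost_iff)
qed

lemma edge_action_edge_weights:
  assumes "w \<in> networks d"
  shows "edge_action d \<sigma> (edge_weights d w) = edge_weights d (network_action d \<sigma> w)"
proof -
  have "edge_weights d w \<in> orthant (d choose 2)"
    using bij_betwE[OF bij_betw_edge_weights] assms by blast
  moreover have "inv_into (networks d) (edge_weights d) (edge_weights d w) = w"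
    using assms bij_betw_imp_inj_on[OF bij_betw_edge_weights] by simp
  ultimately show ?thesis by (simp add: edge_action_def)
qed

lemma group_action_sym_groupI:
  assumes ext: "\<And>\<sigma>. \<phi> \<sigma> \<in> extensional E"
    and closed: "\<And>\<sigma> x. \<sigma> \<in> carrier (sym_group d) \<Longrightarrow> x \<in> E \<Longrightarrow> \<phi> \<sigma> x \<in> E"
    and one: "\<And>x. x \<in> E \<Longrightarrow> \<phi> id x = x"
    and comp: "\<And>\<sigma> \<tau> x. \<sigma> \<in> carrier (sym_group d) \<Longrightarrow> \<tau> \<in> carrier (sym_group d) \<Longrightarrow> x \<in> E
                  \<Longrightarrow> \<phi> (\<sigma> \<circ> \<tau>) x = \<phi> \<sigma> (\<phi> \<tau> x)"
  shows "group_action (sym_group d) E \<phi>"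
proof -
  have "\<phi> \<sigma> \<in> Bij E" if s: "\<sigma> \<in> carrier (sym_group d)" for \<sigma>
  proof -
    have s': "inv' \<sigma> \<in> carrier (sym_group d)" and p: "\<sigma> permutes {1..d}"
      using s by (simp_all add: sym_group_carrier permutes_inv)
    have "\<phi> \<sigma> (\<phi> (inv' \<sigma>) x) = x" "\<phi> (inv' \<sigma>) (\<phi> \<sigma> x) = x" if "x \<in> E" for x
      using comp[OF s s' that] comp[OF s' s that] one[OF that] permutes_inv_o[OF p] by simp_all
    then have "bij_betw (\<phi> \<sigma>) E E"
      using closed[OF s] closed[OF s'] by (intro bij_betw_byWitness[where f' = "\<phi> (inv' \<sigma>)"]) auto
    then show ?thesis using ext by (simp add: Bij_def)
  qed
  moreover have "\<phi> (\<sigma> \<circ> \<tau>) = compose E (\<phi> \<sigma>) (\<phi> \<tau>)"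
    if "\<sigma> \<in> carrier (sym_group d)" "\<tau> \<in> carrier (sym_group d)" for \<sigma> \<tau>
    using comp[OF that] ext[of "\<sigma> \<circ> \<tau>"] by (auto simp: compose_def extensional_def fun_eq_iff)
  ultimately have "\<phi> \<in> hom (sym_group d) (BijGroup E)"
    by (auto simp: hom_def BijGroup_def sym_group_mult)
  then show ?thesis
    by (simp add: group_action_def group_hom_def group_hom_axioms_def sym_group_is_group group_BijGroup)
qed

lemma network_action_comp:
  assumes "\<sigma> \<in> carrier (sym_group d)" "\<tau> \<in> carrier (sym_group d)" "w \<in> networks d"
  shows "network_action d (\<sigma> \<circ> \<tau>) w = network_action d \<sigma> (network_action d \<tau> w)"
proof -
  have "inv' (\<sigma> \<circ> \<tau>) = inv' \<tau> \<circ> inv' \<sigma>"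
    using assms by (intro o_inv_distrib) (auto simp: sym_group_carrier permutes_bij)
  then show ?thesis
    using assms network_action_closed[of \<tau> d w] by (simp add: network_action_def)
qed

lemma group_action_networks: "group_action (sym_group d) (networks d) (network_action d)"
  by (rule group_action_sym_groupI)
     (auto simp: network_action_closed network_action_comp, auto simp: network_action_def)

lemma group_action_orthant: "group_action (sym_group d) (orthant (d choose 2)) (edge_action d)"
proof -
  have im: "orthant (d choose 2) = edge_weights d ` networks d"
    using bij_betw_imp_surj_on[OF bij_betw_edge_weights] by simp
  have one: "network_action d id w = w" if "w \<in> networks d" for w
    using that by (simp add: network_action_def)
  show ?thesis
    by (rule group_action_sym_groupI)
       (auto simp: im edge_action_edge_weights network_action_closed network_action_comp one,
        auto simp: edge_action_def im)
qed

lemma topspace_network_topology: "topspace (network_topology d) = networks d"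
  using bij_betwE[OF bij_betw_edge_weights[of d]]
  by (auto simp: network_topology_def topspace_pullback_topology orthant_def)

lemma topspace_orthant_topology: "topspace (orthant_topology n) = orthant n"
  by (auto simp: orthant_topology_def orthant_def)

lemma homeomorphic_map_edge_weights:
  "homeomorphic_map (network_topology d) (orthant_topology (d choose 2)) (edge_weights d)"
proof -
  let ?f = "edge_weights d" and ?N = "networks d" and ?O = "orthant (d choose 2)"
  have im: "?f ` ?N = ?O" and inj: "inj_on ?f ?N"
    using bij_betw_edge_weights[of d] by (auto simp: bij_betw_def)
  have "continuous_map (network_topology d) (Euclidean_space (d choose 2)) ?f"
    using continuous_map_pullback[OF continuous_map_id[of "Euclidean_space (d choose 2)"], of ?N ?f]
    by (simp add: network_topology_def o_def)
  then have cont: "continuous_map (network_topology d) (orthant_topology (d choose 2)) ?f"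
    using im by (auto simp: orthant_topology_def continuous_map_in_subtopology topspace_network_topology)
  have "open_map (network_topology d) (orthant_topology (d choose 2)) ?f"
    unfolding open_map_def
  proof (intro allI impI)
    fix U assume "openin (network_topology d) U"
    then obtain V where V: "openin (Euclidean_space (d choose 2)) V" "U = ?f -` V \<inter> ?N"
      by (auto simp: network_topology_def openin_pullback_topology)
    then have "?f ` U = V \<inter> ?O" unfolding im[symmetric] by blast
    then show "openin (orthant_topology (d choose 2)) (?f ` U)"
      using V by (auto simp: orthant_topology_def openin_subtopology)
  qed
  then show ?thesis
    using cont im inj
    by (simp add: bijective_open_imp_homeomorphic_map topspace_network_topology topspace_orthant_topology)
qed

lemma unlabeled_networks_homeomorphic:
  "quotient_topology (network_topology d) (orbit (sym_group d) (network_action d))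
     homeomorphic_space unlabeled_networks d"
proof -
  let ?f = "edge_weights d"
  let ?p = "orbit (sym_group d) (network_action d)" and ?q = "orbit (sym_group d) (edge_action d)"
  let ?Y = "quotient_topology (network_topology d) ?p"
  have inj: "inj_on ?f (networks d)"
    using bij_betw_edge_weights[of d] by (auto simp: bij_betw_def)
  have orb: "?q (?f w) = ?f ` ?p w" if "w \<in> networks d" for w
    using that by (auto simp: orbit_def edge_action_edge_weights)
  have sub: "?p w \<subseteq> networks d" if "w \<in> networks d" for w
    using that network_action_closed by (auto simp: orbit_def)
  have q: "quotient_map (network_topology d) (unlabeled_networks d) (?q \<circ> ?f)"
    unfolding unlabeled_networks_def
    by (rule quotient_map_compose[OF homeomorphic_map_edge_weights[unfolded homeomorphic_map_def, THEN conjunct1]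
          quotient_map_quotient_topology])
  have same: "?p v = ?p w \<longleftrightarrow> (?q \<circ> ?f) v = (?q \<circ> ?f) w" if "v \<in> networks d" "w \<in> networks d" for v w
    using that inj sub by (simp add: orb inj_on_image_eq_iff)
  have p: "quotient_map (network_topology d) ?Y ?p"
    by (rule quotient_map_quotient_topology)
  let ?N = "network_topology d" and ?h = "?q \<circ> ?f"
  have same': "?h v = ?h w" if "v \<in> topspace ?N" "w \<in> topspace ?N" "?p v = ?p w" for v w
    using that same unfolding topspace_network_topology by blast
  have same'': "?p v = ?p w" if "v \<in> topspace ?N" "w \<in> topspace ?N" "?h v = ?h w" for v w
    using that same unfolding topspace_network_topology by blast
  have "\<exists>g. continuous_map ?Y (unlabeled_networks d) g \<and> (\<forall>w \<in> topspace ?N. g (?p w) = ?h w)"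
    by (rule quotient_map_lift_exists[OF p quotient_imp_continuous_map[OF q]], erule (2) same') blast
  then obtain g where g: "continuous_map ?Y (unlabeled_networks d) g"
      and g_p: "\<And>w. w \<in> topspace ?N \<Longrightarrow> g (?p w) = ?h w"
    by (elim exE conjE) (rule that, assumption, erule (1) bspec)
  have "\<exists>g'. continuous_map (unlabeled_networks d) ?Y g' \<and> (\<forall>w \<in> topspace ?N. g' (?h w) = ?p w)"
    by (rule quotient_map_lift_exists[OF q quotient_imp_continuous_map[OF p]], erule (2) same'') blast
  then obtain g' where g': "continuous_map (unlabeled_networks d) ?Y g'"
      and g'_h: "\<And>w. w \<in> topspace ?N \<Longrightarrow> g' (?h w) = ?p w"
    by (elim exE conjE) (rule that, assumption, erule (1) bspec)
  have "g' (g y) = y" if y: "y \<in> topspace ?Y" for y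
  proof -
    obtain w where w: "w \<in> topspace ?N" "y = ?p w"
      using y unfolding quotient_imp_surjective_map[OF p, symmetric] by blast
    show ?thesis unfolding w(2) g_p[OF w(1)] g'_h[OF w(1)] ..
  qed
  moreover have "g (g' z) = z" if z: "z \<in> topspace (unlabeled_networks d)" for z
  proof -
    obtain w where w: "w \<in> topspace ?N" "z = ?h w"
      using z unfolding quotient_imp_surjective_map[OF q, symmetric] by blast
    show ?thesis unfolding w(2) g'_h[OF w(1)] g_p[OF w(1)] ..
  qed
  ultimately have "homeomorphic_maps ?Y (unlabeled_networks d) g g'"
    using g g' unfolding homeomorphic_maps_def by blast
  then show ?thesis
    unfolding homeomorphic_space_def by blast
qed

end

theory Submission
  imports Defs
begin

text \<open>Divide the orthant into the open cones (cells) on which the relative order of \<open>0\<close> and all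
  coordinates is constant. A permutation of the coordinates permutes the cells, and one that
  maps a point into its own cell fixes it, since the sorted list of values does not change. Hence
  the orbit map is injective on every cell, and being closed it maps the cell homeomorphically onto
  its image. These images are the strata: a cell is an open subset of a Euclidean space, and
  its closure is the union of the cells on which some of its strict inequalities have become
  equalities.\<close>

section \<open>Order patterns\<close>

text \<open>A point of \<^term>\<open>orthant n\<close> vanishes at the index \<open>n\<close>, so comparing with that coordinate
  records which coordinates are zero.\<close>

definition pattern :: "nat \<Rightarrow> (nat \<Rightarrow> real) \<Rightarrow> (nat \<times> nat) set" where
  "pattern n x = {(i, j). i \<le> n \<and> j \<le> n \<and> x i \<le> x j}"

definition cell :: "nat \<Rightarrow> (nat \<Rightarrow> real) \<Rightarrow> (nat \<Rightarrow> real) set" where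
  "cell n x = {y \<in> orthant n. pattern n y = pattern n x}"

section \<open>The orthant as a subspace of the function space\<close>

lemma orthant_iff: "x \<in> orthant n \<longleftrightarrow> (\<forall>i. 0 \<le> x i) \<and> (\<forall>i\<ge>n. x i = 0)"
  by (auto simp: orthant_def topspace_Euclidean_space) (metis order_refl linorder_not_le)

lemma Euclidean_space_eq_top_of_set: "Euclidean_space n = top_of_set {x. \<forall>i\<ge>n. x i = 0}"
  by (simp add: Euclidean_space_def euclidean_product_topology)

lemma orthant_topology_eq_top_of_set: "orthant_topology n = top_of_set (orthant n)"
proof -
  have "{x. \<forall>i\<ge>n. x i = 0} \<inter> orthant n = orthant n"
    by (auto simp: orthant_iff)
  then show ?thesis
    by (simp add: orthant_topology_def Euclidean_space_eq_top_of_set subtopology_subtopology)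
qed

lemma second_countable_top_of_set:
  "second_countable (top_of_set (S :: 'a :: second_countable_topology set))"
proof (rule second_countable_subtopology)
  obtain \<B> :: "'a set set" where "countable \<B>" "topological_basis \<B>"
    using ex_countable_basis by blast
  then show "second_countable (euclidean :: 'a topology)"
    unfolding second_countable_def
    using topological_basis_open topological_basisE by (metis open_openin)
qed

lemma pattern_subset: "pattern n x \<subseteq> {..n} \<times> {..n}"
  by (auto simp: pattern_def)

lemma finite_pattern: "finite (pattern n x)"
  using finite_subset[OF pattern_subset] by blast

lemma continuous_on_coordinate: "continuous_on A (\<lambda>y :: 'i \<Rightarrow> 'a :: topological_space. y i)"
  by (rule continuous_on_subset[OF continuous_on_product_coordinates]) simp

lemma closed_coordinate_le: "closed {y :: 'i \<Rightarrow> real. y i \<le> y j}"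
  by (intro closed_Collect_le continuous_on_coordinate)

text \<open>Membership of a pair in the pattern is a weak, hence closed, inequality; containing
  \<open>P\<close> is an intersection of such conditions.\<close>

lemma closedin_pattern_superset:
  assumes "P \<subseteq> {..n} \<times> {..n}"
  shows "closedin (top_of_set (orthant n)) {y \<in> orthant n. P \<subseteq> pattern n y}"
proof -
  have "{y \<in> orthant n. P \<subseteq> pattern n y} = orthant n \<inter> (\<Inter>(i, j)\<in>P. {y. y i \<le> y j})"
    using assms by (fastforce simp: pattern_def)
  moreover have "closed (\<Inter>(i, j)\<in>P. {y :: nat \<Rightarrow> real. y i \<le> y j})"
    by (intro closed_INT) (auto simp: closed_coordinate_le)
  ultimately show ?thesis
    by (auto simp: closedin_closed)
qed

text \<open>Only finitely many patterns exist, so this is a finite union of closed sets. Unlike the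
  pattern, its size is invariant under permutations of the coordinates and so makes sense on
  orbits.\<close>

lemma closedin_card_pattern_ge:
  "closedin (top_of_set (orthant n)) {y \<in> orthant n. m \<le> card (pattern n y)}"
proof -
  let ?\<P> = "{P. P \<subseteq> {..n} \<times> {..n} \<and> m \<le> card P}"
  have "{y \<in> orthant n. m \<le> card (pattern n y)} = (\<Union>P\<in>?\<P>. {y \<in> orthant n. P \<subseteq> pattern n y})"
    using pattern_subset card_mono[OF finite_pattern] by (auto intro: order_trans)
  moreover have "closedin (top_of_set (orthant n)) (\<Union>P\<in>?\<P>. {y \<in> orthant n. P \<subseteq> pattern n y})"
    by (intro closedin_Union) (auto intro: closedin_pattern_superset)
  ultimately show ?thesis
    by simp
qed

text \<open>Where \<open>x\<close> has a tie, so has \<open>y\<close>; where \<open>x\<close> is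
  strict, \<open>y\<close> is ordered the same way at least weakly, and the positive multiple of
  \<open>x\<close> adds strictness.\<close>

lemma pattern_add_scaled:
  assumes "pattern n x \<subseteq> pattern n y" "0 < t"
  shows "pattern n (\<lambda>i. y i + t * x i) = pattern n x"
proof -
  have le: "y i \<le> y j" if "i \<le> n" "j \<le> n" "x i \<le> x j" for i j
    using assms(1) that by (auto simp: pattern_def)
  have "y i + t * x i \<le> y j + t * x j \<longleftrightarrow> x i \<le> x j" if "i \<le> n" "j \<le> n" for i j
  proof (cases "x i \<le> x j")
    case True
    then show ?thesis
      using le that assms(2) by (simp add: add_mono)
  next
    case False
    then show ?thesis
      using le[of j i] that assms(2) by (simp add: add_le_less_mono not_le)
  qed
  then show ?thesis
    by (auto simp: pattern_def)
qed

text \<open>The right-hand side is closed and contains the cell. Conversely, \<open>y\<close> is a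
  limit of points \<open>y + t * x\<close> with \<open>t > 0\<close>, which lie in the cell.\<close>

lemma closure_of_cell:
  assumes "x \<in> orthant n"
  shows "top_of_set (orthant n) closure_of cell n x = {y \<in> orthant n. pattern n x \<subseteq> pattern n y}"
proof
  show "top_of_set (orthant n) closure_of cell n x \<subseteq> {y \<in> orthant n. pattern n x \<subseteq> pattern n y}"
    by (intro closure_of_minimal closedin_pattern_superset pattern_subset) (auto simp: cell_def)
next
  show "{y \<in> orthant n. pattern n x \<subseteq> pattern n y} \<subseteq> top_of_set (orthant n) closure_of cell n x"
  proof clarify
    fix y assume y: "y \<in> orthant n" "pattern n x \<subseteq> pattern n y"
    define f where "f k = (\<lambda>i. y i + inverse (real (Suc k)) * x i)" for k
    have "f k \<in> cell n x" for k
      using y assms pattern_add_scaled[OF y(2), of "inverse (real (Suc k))"]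
      by (auto simp: f_def cell_def orthant_iff)
    moreover have "f \<longlonglongrightarrow> y"
    proof -
      \<comment> \<open>Regarded as a continuous curve in the scale, the sequence converges because
        \<open>1 / (k + 1)\<close> tends to \<open>0\<close>.\<close>
      define h where "h t = (\<lambda>i. y i + t * x i)" for t
      have "continuous_on UNIV h"
        unfolding h_def by (intro continuous_intros)
      then have "isCont h 0"
        by (simp add: continuous_on_eq_continuous_at)
      then have "(\<lambda>k. h (inverse (real (Suc k)))) \<longlonglongrightarrow> h 0"
        using LIMSEQ_inverse_real_of_nat by (rule isCont_tendsto_compose)
      then show ?thesis
        by (simp add: f_def[abs_def] h_def)
    qed
    ultimately have "y \<in> closure (cell n x)"
      unfolding closure_sequential by blast
    moreover have "cell n x \<subseteq> orthant n"
      by (auto simp: cell_def)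
    ultimately show "y \<in> top_of_set (orthant n) closure_of cell n x"
      using y by (simp add: closure_of_subtopology Int_absorb1)
  qed
qed

section \<open>Patterns under permutations of the coordinates\<close>

text \<open>The index \<open>n\<close>, which stands for the value \<open>0\<close>, is fixed by
  \<open>\<pi>\<close>, so the index range of patterns is preserved.\<close>

lemma permutes_le_iff:
  fixes n :: nat
  assumes "\<pi> permutes {..<n}"
  shows "\<pi> i \<le> n \<longleftrightarrow> i \<le> n"
proof -
  have "\<pi> permutes {..n}"
    using assms by (rule permutes_subset) auto
  from permutes_in_image[OF this] show ?thesis
    by simp
qed

lemma pattern_comp:
  assumes "\<pi> permutes {..<n}"
  shows "pattern n (x \<circ> \<pi>) = map_prod \<pi> \<pi> -` pattern n x"
  by (auto simp: pattern_def permutes_le_iff[OF assms])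

lemma card_pattern_comp:
  assumes "\<pi> permutes {..<n}"
  shows "card (pattern n (x \<circ> \<pi>)) = card (pattern n x)"
proof -
  have "bij (map_prod \<pi> \<pi>)"
    using permutes_bij[OF assms] by (simp add: bij_def prod.inj_map map_prod_surj)
  then show ?thesis
    unfolding pattern_comp[OF assms] by (intro card_vimage_inj) (auto simp: bij_def)
qed

text \<open>Equal patterns preserve the rank of a coordinate among all values, and the rank determines
  the value.\<close>

lemma comp_eq_if_pattern_eq:
  assumes "\<pi> permutes {..<n}" "pattern n (x \<circ> \<pi>) = pattern n x"
  shows "x \<circ> \<pi> = x"
proof
  fix i
  define below where "below i = {j. j \<le> n \<and> x j \<le> x i}" for i
  have fin: "finite (below i)" for i
    by (auto simp: below_def)
  show "(x \<circ> \<pi>) i = x i"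
  proof (cases "i \<le> n")
    case True
    have "\<pi> -` below (\<pi> i) = below i"
    proof -
      have "x (\<pi> j) \<le> x (\<pi> i) \<longleftrightarrow> x j \<le> x i" if "j \<le> n" for j
        using assms(2) True that by (auto simp: pattern_def set_eq_iff)
      then show ?thesis
        by (auto simp: below_def permutes_le_iff[OF assms(1)])
    qed
    moreover have "card (\<pi> -` below (\<pi> i)) = card (below (\<pi> i))"
      using permutes_bij[OF assms(1)] by (intro card_vimage_inj) (auto simp: bij_def)
    ultimately have card: "card (below (\<pi> i)) = card (below i)"
      by simp
    \<comment> \<open>The index \<open>b\<close> is counted in \<open>below b\<close> but not in
      \<open>below a\<close>. Hence equal ranks force equal values.\<close>
    have less: "card (below a) < card (below b)" if "x a < x b" "b \<le> n" for a b
      using that by (intro psubset_card_mono[OF fin]) (force simp: below_def)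
    have "\<pi> i \<le> n"
      using True by (simp add: permutes_le_iff[OF assms(1)])
    then show ?thesis
      using less[of i "\<pi> i"] less[of "\<pi> i" i] card True by (force simp: not_less)
  next
    case False
    then show ?thesis
      using permutes_not_in[OF assms(1)] by simp
  qed
qed

section \<open>Cells are open subsets of Euclidean spaces\<close>

text \<open>A point of the cell is constant on each level set of \<open>x\<close> and vanishes where
  \<open>x\<close> does. One parameter for each of the \<open>k\<close> distinct nonzero values of
  \<open>x\<close> thus describes it, and these parameters are restricted by strict inequalities
  only.\<close>

lemma cell_homeomorphic_open:
  assumes x: "x \<in> orthant n"
  obtains k V where "openin (Euclidean_space k) V"
    "top_of_set (cell n x) homeomorphic_space subtopology (Euclidean_space k) V"
proof -
  define P where "P = x ` {..<n} - {0}"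
  have "finite P"
    by (simp add: P_def)
  then obtain b where b: "bij_betw b P {..<card P}"
    using ex_bij_betw_finite_nat[of P] by (auto simp: atLeast0LessThan)
  define k where "k = card P"
  define E where "E = {t :: nat \<Rightarrow> real. \<forall>i\<ge>k. t i = 0}"
  have "\<forall>m\<in>{..<k}. \<exists>i<n. x i \<noteq> 0 \<and> b (x i) = m"
  proof
    fix m assume "m \<in> {..<k}"
    then have "m \<in> b ` P"
      using b by (simp add: bij_betw_def k_def)
    then show "\<exists>i<n. x i \<noteq> 0 \<and> b (x i) = m"
      by (auto simp: P_def)
  qed
  \<comment> \<open>\<open>r m\<close> is a coordinate at which \<open>x\<close> takes the nonzero
    value numbered \<open>m\<close> by \<open>b\<close>.\<close>
  then obtain r where r: "\<And>m. m < k \<Longrightarrow> r m < n \<and> x (r m) \<noteq> 0 \<and> b (x (r m)) = m"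
    by (metis lessThan_iff)
  have x0: "x i = 0" if "i \<ge> n" for i
    using x that by (simp add: orthant_iff)
  have xP: "x i \<in> P" if "x i \<noteq> 0" for i
    using that x0[of i] by (fastforce simp: P_def)
  have b_less: "b (x i) < k" if "x i \<noteq> 0" for i
    using bij_betwE[OF b] xP[OF that] by (simp add: k_def)
  have x_r: "x (r (b (x i))) = x i" if "x i \<noteq> 0" for i
    using r[OF b_less[OF that]] xP[OF that] xP[of "r (b (x i))"] bij_betw_imp_inj_on[OF b]
    by (meson inj_onD)
  \<comment> \<open>\<open>f\<close> spreads the level values over the coordinates, and
    \<open>g\<close> reads them off at the representatives \<open>r m\<close>.\<close>
  define f where "f t i = (if x i = 0 then 0 else t (b (x i)) :: real)" for t i
  define g where "g y m = (if m < k then y (r m) else 0 :: real)" for y m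
  \<comment> \<open>The pairs with \<open>i = n\<close> make the level values positive, because
    \<open>f t n = 0\<close>.\<close>
  define V where "V = E \<inter> (\<Inter>(i, j)\<in>{(i, j). i \<le> n \<and> j \<le> n \<and> x i < x j}. {t. f t i < f t j})"
  have f_cont: "continuous_on A (\<lambda>t. f t i)" for A i
    unfolding f_def by (cases "x i = 0") (auto intro!: continuous_intros continuous_on_coordinate)
  have "open (\<Inter>(i, j)\<in>{(i, j). i \<le> n \<and> j \<le> n \<and> x i < x j}. {t. f t i < f t j})"
  proof (intro open_INT ballI)
    show "finite {(i, j). i \<le> n \<and> j \<le> n \<and> x i < x j}"
      by (rule finite_subset[of _ "{..n} \<times> {..n}"]) auto
  qed (auto intro!: open_Collect_less f_cont)
  then have V: "openin (Euclidean_space k) V"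
    unfolding V_def E_def Euclidean_space_eq_top_of_set by (rule openin_open_Int)
  have f_cell: "f t \<in> cell n x" if "t \<in> V" for t
  proof -
    have less: "f t i < f t j" if "i \<le> n" "j \<le> n" "x i < x j" for i j
      using \<open>t \<in> V\<close> that by (auto simp: V_def)
    have eq: "f t i = f t j" if "x i = x j" for i j
      using that by (simp add: f_def)
    have iff: "f t i \<le> f t j \<longleftrightarrow> x i \<le> x j" if "i \<le> n" "j \<le> n" for i j
      using less[of i j] less[of j i] eq[of i j] that by (cases "x i" "x j" rule: linorder_cases) auto
    have 0: "f t i = 0" if "i \<ge> n" for i
      using x0 that by (simp add: f_def)
    \<comment> \<open>Coordinate \<open>n\<close> holds \<open>0\<close>, so nonnegativity is the
      comparison of \<open>n\<close> with \<open>i\<close>, inherited from \<open>x\<close>.\<close>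
    have "0 \<le> f t i" for i
    proof (cases "i \<le> n")
      case True
      then show ?thesis
        using iff[of n i] 0[of n] x0[of n] x by (simp add: orthant_iff)
    qed (simp add: 0)
    then show ?thesis
      using iff 0 by (auto simp: cell_def orthant_iff pattern_def)
  qed
  have cell_eq: "y i = y j" if "y \<in> cell n x" "x i = x j" "i \<le> n" "j \<le> n" for y i j
  proof -
    have "(i, j) \<in> pattern n y" "(j, i) \<in> pattern n y"
      using that by (simp_all add: cell_def pattern_def)
    then show ?thesis
      by (simp add: pattern_def)
  qed
  have fg: "f (g y) = y" if "y \<in> cell n x" for y
  proof
    fix i
    have y0: "y i = 0" if "i \<ge> n" for i
      using \<open>y \<in> cell n x\<close> that by (auto simp: cell_def orthant_iff)
    show "f (g y) i = y i"
    proof (cases "x i = 0")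
      case True
      then have "y i = 0"
        using cell_eq[OF that, of i n] x0[of n] y0[of n] y0[of i] by (cases "i \<le> n") auto
      then show ?thesis
        using True by (simp add: f_def)
    next
      case False
      then have "i < n"
        using x0[of i] by (cases "i < n") auto
      then show ?thesis
        using False b_less[OF False] x_r[OF False] r[OF b_less[OF False]]
          cell_eq[OF that, of "r (b (x i))" i]
        by (simp add: f_def g_def)
    qed
  qed
  have gf: "g (f t) = t" if "t \<in> V" for t
    using that r by (auto simp: g_def f_def V_def E_def)
  have g_V: "g y \<in> V" if y: "y \<in> cell n x" for y
  proof -
    have "y i < y j" if "i \<le> n" "j \<le> n" "x i < x j" for i j
    proof -
      have "(j, i) \<notin> pattern n y"
        using y that by (simp add: cell_def pattern_def)
      then show ?thesis
        using that by (simp add: pattern_def)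
    qed
    then show ?thesis
      by (auto simp: V_def E_def fg[OF y] g_def)
  qed
  have "homeomorphic_maps (top_of_set (cell n x)) (top_of_set V) g f"
    unfolding homeomorphic_maps_def
  proof (intro conjI)
    have g_cont: "continuous_on A (\<lambda>y. g y m)" for A m
      unfolding g_def by (cases "m < k") (auto intro!: continuous_intros continuous_on_coordinate)
    show "continuous_map (top_of_set (cell n x)) (top_of_set V) g"
      using g_V g_cont by (auto intro: continuous_on_coordinatewise_then_product)
    show "continuous_map (top_of_set V) (top_of_set (cell n x)) f"
      using f_cell f_cont by (auto intro: continuous_on_coordinatewise_then_product)
  qed (use fg gf in auto)
  moreover have "subtopology (Euclidean_space k) V = top_of_set V"
    by (simp add: Euclidean_space_eq_top_of_set subtopology_subtopology V_def E_def Int_absorb1)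
  ultimately show thesis
    using V that by (metis homeomorphic_space_def)
qed

section \<open>Quotients of the orthant by groups permuting the coordinates\<close>

text \<open>The graph structure is abstracted away: what remains is a finite group each of whose
  elements acts by some permutation of the coordinates.\<close>

locale orthant_permutation_action = group_action G "orthant n" \<phi>
  for G (structure) and n :: nat and \<phi> +
  assumes finite_group: "finite (carrier G)"
    and permuting: "g \<in> carrier G \<Longrightarrow> \<exists>\<pi>. \<pi> permutes {..<n} \<and> (\<forall>x \<in> orthant n. \<phi> g x = x \<circ> \<pi>)"
begin

abbreviation "q \<equiv> orbit G \<phi>"
abbreviation "X \<equiv> top_of_set (orthant n)"
abbreviation "Y \<equiv> quotient_topology X q"

section \<open>Orbits and saturations\<close>

lemma q_eq_iff:
  assumes "x \<in> orthant n" "y \<in> orthant n"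
  shows "q x = q y \<longleftrightarrow> (\<exists>g \<in> carrier G. y = \<phi> g x)"
proof
  assume "q x = q y"
  then have "y \<in> q x"
    using orbit_refl[OF assms(2)] by simp
  then show "\<exists>g \<in> carrier G. y = \<phi> g x"
    by (auto simp: orbit_def)
next
  assume "\<exists>g \<in> carrier G. y = \<phi> g x"
  then have y: "y \<in> q x"
    by (auto simp: orbit_def)
  have sub: "q z \<subseteq> orthant n" if "z \<in> orthant n" for z
    using element_image that by (auto simp: orbit_def)
  show "q x = q y"
  proof
    show "q x \<subseteq> q y"
      using orbit_trans[OF assms(2,1) _ orbit_sym[OF assms y]] sub[OF assms(1)] by blast
    show "q y \<subseteq> q x"
      using orbit_trans[OF assms _ y] sub[OF assms(2)] by blast
  qed
qed

lemma q_action: "g \<in> carrier G \<Longrightarrow> x \<in> orthant n \<Longrightarrow> q (\<phi> g x) = q x"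
  using q_eq_iff element_image by metis

lemma continuous_on_action:
  assumes "g \<in> carrier G"
  shows "continuous_on (orthant n) (\<phi> g)"
proof -
  obtain \<pi> where "\<And>x. x \<in> orthant n \<Longrightarrow> \<phi> g x = x \<circ> \<pi>"
    using permuting[OF assms] by blast
  moreover have "continuous_on (orthant n) (\<lambda>x. x \<circ> \<pi>)"
    by (auto intro!: continuous_on_coordinatewise_then_product continuous_on_coordinate simp: o_def)
  ultimately show ?thesis
    by (simp cong: continuous_on_cong)
qed

text \<open>Writing the saturation as a union of preimages under group elements lets continuity of
  the action decide whether it is open or closed.\<close>

lemma saturation_eq:
  assumes "K \<subseteq> orthant n"
  shows "{x \<in> orthant n. q x \<in> q ` K} = (\<Union>g\<in>carrier G. {x \<in> orthant n. \<phi> g x \<in> K})"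
proof (intro equalityI subsetI)
  fix x assume "x \<in> {x \<in> orthant n. q x \<in> q ` K}"
  then obtain y where "x \<in> orthant n" "y \<in> K" "q x = q y"
    by blast
  then show "x \<in> (\<Union>g\<in>carrier G. {x \<in> orthant n. \<phi> g x \<in> K})"
    using q_eq_iff[of x y] assms by blast
next
  fix x assume "x \<in> (\<Union>g\<in>carrier G. {x \<in> orthant n. \<phi> g x \<in> K})"
  then obtain g where "g \<in> carrier G" "x \<in> orthant n" "\<phi> g x \<in> K"
    by blast
  then show "x \<in> {x \<in> orthant n. q x \<in> q ` K}"
    using q_action[of g x] by (metis (mono_tags, lifting) image_eqI mem_Collect_eq)
qed

section \<open>Topology of the orbit map and the orbit space\<close>

lemma quotient_map_q: "quotient_map X Y q"
  by (rule quotient_map_quotient_topology)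

lemma continuous_map_q: "continuous_map X Y q"
  using quotient_map_q by (rule quotient_imp_continuous_map)

lemma topspace_Y: "topspace Y = q ` orthant n"
  by (simp add: topspace_quotient_topology)

lemma action_continuous_map: "g \<in> carrier G \<Longrightarrow> continuous_map X X (\<phi> g)"
  using continuous_on_action element_image by auto

lemma open_map_q: "open_map X Y q"
proof -
  have "openin Y (q ` U)" if U: "openin X U" for U
  proof -
    have "U \<subseteq> orthant n"
      using openin_subset[OF U] by simp
    moreover have "openin X (\<Union>g\<in>carrier G. {x \<in> orthant n. \<phi> g x \<in> U})"
      using openin_continuous_map_preimage[OF action_continuous_map U] by (intro openin_Union) auto
    ultimately show ?thesis
      by (auto simp: openin_quotient_topology saturation_eq)
  qed
  then show ?thesis
    by (simp add: open_map_def)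
qed

text \<open>Finiteness of the group makes the saturation of a closed set a finite union of closed
  sets.\<close>

lemma closed_map_q: "closed_map X Y q"
proof -
  have "closedin Y (q ` K)" if K: "closedin X K" for K
  proof -
    have sub: "K \<subseteq> orthant n"
      using closedin_subset[OF K] by simp
    have "closedin X (\<Union>g\<in>carrier G. {x \<in> orthant n. \<phi> g x \<in> K})"
      using closedin_continuous_map_preimage[OF action_continuous_map K] finite_group
      by (intro closedin_Union) auto
    then have "closedin X {x \<in> topspace X. q x \<in> q ` K}"
      using sub by (simp add: saturation_eq)
    moreover have "q ` K \<subseteq> topspace Y"
      using sub topspace_Y by auto
    ultimately show ?thesis
      using quotient_map_q unfolding quotient_map_closedin by blast
  qed
  then show ?thesis
    by (simp add: closed_map_def)
qed

text \<open>One inclusion is closedness of \<open>q\<close>, the other its continuity. This carries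
  the description of closures of cells over to the strata.\<close>

lemma closure_of_image_q:
  assumes "A \<subseteq> orthant n"
  shows "Y closure_of (q ` A) = q ` (X closure_of A)"
proof
  show "Y closure_of (q ` A) \<subseteq> q ` (X closure_of A)"
    using closed_map_q assms unfolding closed_map_closure_of_image by simp
  show "q ` (X closure_of A) \<subseteq> Y closure_of (q ` A)"
    using continuous_map_q by (rule continuous_map_image_closure_subset)
qed

lemma second_countable_Y: "second_countable Y"
  by (rule second_countable_open_map_image[OF continuous_map_q open_map_q _ second_countable_top_of_set])
     (simp add: topspace_Y)

text \<open>The orthant is metrizable, hence normal, and normality passes to images under continuous
  closed maps; points of \<open>Y\<close> are closed as images of closed points.\<close>

lemma Hausdorff_space_Y: "Hausdorff_space Y"
proof -
  have "normal_space X"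
    by (intro metrizable_imp_normal_space metrizable_space_subtopology metrizable_space_euclidean)
  then have "normal_space Y"
    using continuous_map_q closed_map_q topspace_Y
    by (metis normal_space_continuous_closed_map_image topspace_euclidean_subtopology)
  moreover have "t1_space Y"
    unfolding t1_space_closedin_singleton topspace_Y
  proof clarify
    fix x assume "x \<in> orthant n"
    then have "closedin X {x}"
      by (auto simp: closedin_closed)
    then have "closedin Y (q ` {x})"
      using closed_map_q by (simp only: closed_map_def)
    then show "closedin Y {q x}"
      by simp
  qed
  ultimately show ?thesis
    by (rule normal_t1_imp_Hausdorff_space)
qed

section \<open>Patterns along orbits\<close>

lemma card_pattern_action:
  assumes "g \<in> carrier G" "x \<in> orthant n"
  shows "card (pattern n (\<phi> g x)) = card (pattern n x)"
proof -
  obtain \<pi> where "\<pi> permutes {..<n}" "\<forall>x \<in> orthant n. \<phi> g x = x \<circ> \<pi>"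
    using permuting[OF assms(1)] by blast
  then show ?thesis
    using assms(2) by (simp add: card_pattern_comp)
qed

lemma card_pattern_q:
  assumes "x \<in> orthant n" "y \<in> orthant n" "q x = q y"
  shows "card (pattern n x) = card (pattern n y)"
  using assms by (auto simp: q_eq_iff card_pattern_action)

lemma pattern_action_cong:
  assumes "g \<in> carrier G" "x \<in> orthant n" "y \<in> orthant n" "pattern n x = pattern n y"
  shows "pattern n (\<phi> g x) = pattern n (\<phi> g y)"
proof -
  obtain \<pi> where "\<pi> permutes {..<n}" "\<forall>x \<in> orthant n. \<phi> g x = x \<circ> \<pi>"
    using permuting[OF assms(1)] by blast
  then show ?thesis
    using assms(2-) by (simp add: pattern_comp)
qed

lemma action_eq_if_pattern_eq:
  assumes "g \<in> carrier G" "x \<in> orthant n" "pattern n (\<phi> g x) = pattern n x"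
  shows "\<phi> g x = x"
proof -
  obtain \<pi> where "\<pi> permutes {..<n}" "\<forall>x \<in> orthant n. \<phi> g x = x \<circ> \<pi>"
    using permuting[OF assms(1)] by blast
  then show ?thesis
    using assms(2-) comp_eq_if_pattern_eq[of \<pi> n x] by simp
qed

text \<open>A group element relating two points of one cell preserves the pattern of the first, so
  it fixes that point.\<close>

lemma inj_on_q_cell: "inj_on q (cell n x)"
proof (rule inj_onI)
  fix y z assume *: "y \<in> cell n x" "z \<in> cell n x" "q y = q z"
  then have yz: "y \<in> orthant n" "z \<in> orthant n" "pattern n y = pattern n z"
    by (auto simp: cell_def)
  then obtain g where "g \<in> carrier G" "z = \<phi> g y"
    using *(3) by (auto simp: q_eq_iff)
  then show "y = z"
    using action_eq_if_pattern_eq[of g y] yz by simp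
qed

section \<open>The strata and their properties\<close>

lemma cell_subset: "cell n x \<subseteq> orthant n"
  by (auto simp: cell_def)

text \<open>Points with the same cell, or with cells exchanged by the group, yield the same
  stratum.\<close>

definition strata :: "(nat \<Rightarrow> real) set set set" where
  "strata = (\<lambda>x. q ` cell n x) ` orthant n"

text \<open>The element taking \<open>x\<close> to \<open>y\<close> maps the cell of
  \<open>x\<close> into that of \<open>y\<close>. Used in both directions, this shows that strata
  that meet are equal.\<close>

lemma q_image_cell_subset:
  assumes "x \<in> orthant n" "y \<in> orthant n" "q x = q y"
  shows "q ` cell n x \<subseteq> q ` cell n y"
proof clarify
  fix z assume z: "z \<in> cell n x"
  obtain g where g: "g \<in> carrier G" "y = \<phi> g x"
    using assms by (auto simp: q_eq_iff)
  have z': "z \<in> orthant n" "pattern n z = pattern n x"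
    using z by (auto simp: cell_def)
  have "\<phi> g z \<in> cell n y"
    using pattern_action_cong[OF g(1) z'(1) assms(1) z'(2)] element_image[OF g(1) z'(1)] g(2)
    by (simp add: cell_def)
  then show "q z \<in> q ` cell n y"
    by (rule image_eqI[where f = q, OF q_action[OF g(1) z'(1), symmetric]])
qed

lemma partition_on_strata: "partition_on (topspace Y) strata"
proof (rule partition_onI)
  show "\<Union>strata = topspace Y"
    by (auto simp: strata_def topspace_Y cell_def)
  show "disjnt S T" if ST: "S \<in> strata" "T \<in> strata" "S \<noteq> T" for S T
  proof (rule ccontr)
    obtain x y where xy: "x \<in> orthant n" "y \<in> orthant n" "S = q ` cell n x" "T = q ` cell n y"
      using ST unfolding strata_def by blast
    assume "\<not> disjnt S T"
    then obtain x' y' where *: "x' \<in> cell n x" "y' \<in> cell n y" "q x' = q y'"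
      by (auto simp: xy disjnt_def)
    then have "x' \<in> orthant n" "y' \<in> orthant n" "cell n x' = cell n x" "cell n y' = cell n y"
      by (auto simp: cell_def)
    then show False
      using q_image_cell_subset[of x' y'] q_image_cell_subset[of y' x'] * ST(3) xy(3,4) by simp
  qed
  show "{} \<notin> strata"
    by (auto simp: strata_def cell_def)
qed

text \<open>Each stratum is determined by a pattern, one of the finitely many subsets of
  \<open>{..n} \<times> {..n}\<close>.\<close>

lemma finite_strata: "finite strata"
proof -
  have "strata \<subseteq> (\<lambda>P. q ` {y \<in> orthant n. pattern n y = P}) ` Pow ({..n} \<times> {..n})"
    using pattern_subset by (fastforce simp: strata_def cell_def)
  then show ?thesis
    by (rule finite_subset) simp
qed

text \<open>Patterns can only grow on the closure of a cell. Removing the closed set of orbits with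
  larger patterns therefore leaves exactly the stratum.\<close>

lemma locally_closed_stratum:
  assumes x: "x \<in> orthant n"
  shows "locally_closed_in Y (q ` cell n x)"
proof -
  let ?m = "card (pattern n x)"
  define C where "C = q ` {y \<in> orthant n. Suc ?m \<le> card (pattern n y)}"
  have C: "closedin Y C"
    using closed_map_q closedin_card_pattern_ge unfolding C_def closed_map_def by blast
  have "q ` cell n x = (topspace Y - C) \<inter> Y closure_of (q ` cell n x)"
  proof
    have "q z \<notin> C" if "z \<in> cell n x" for z
    proof
      assume "q z \<in> C"
      then obtain y where "y \<in> orthant n" "q z = q y" "Suc ?m \<le> card (pattern n y)"
        by (auto simp: C_def)
      then show False
        using that card_pattern_q[of z y] by (simp add: cell_def)
    qed
    moreover have "q ` cell n x \<subseteq> topspace Y"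
      using cell_subset topspace_Y by auto
    ultimately show "q ` cell n x \<subseteq> (topspace Y - C) \<inter> Y closure_of (q ` cell n x)"
      using closure_of_subset by fastforce
    show "(topspace Y - C) \<inter> Y closure_of (q ` cell n x) \<subseteq> q ` cell n x"
    proof
      fix u assume u: "u \<in> (topspace Y - C) \<inter> Y closure_of (q ` cell n x)"
      then obtain w where w: "u = q w" "w \<in> orthant n" "pattern n x \<subseteq> pattern n w"
        by (auto simp: closure_of_image_q[OF cell_subset] closure_of_cell[OF x])
      then have "card (pattern n w) \<le> ?m"
        using u by (force simp: C_def)
      then have "pattern n x = pattern n w"
        using w(3) by (intro card_seteq finite_pattern)
      then show "u \<in> q ` cell n x"
        using w by (auto simp: cell_def)
    qed
  qed
  then show ?thesis
    unfolding locally_closed_in_def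
    by (intro exI[of _ "topspace Y - C"] exI[of _ "Y closure_of (q ` cell n x)"] conjI
        openin_diff[OF openin_topspace C] closedin_closure_of)
qed

text \<open>The other cells over the same stratum have patterns of the same cardinality, so they do not
  meet the closure of the cell; hence the cell is closed in the preimage of its stratum.\<close>

lemma homeomorphic_map_q_cell:
  assumes x: "x \<in> orthant n"
  shows "homeomorphic_map (top_of_set (cell n x)) (subtopology Y (q ` cell n x)) q"
proof -
  let ?C = "cell n x"
  \<comment> \<open>A closed map stays closed when restricted to a full preimage and then to a
    closed subset of it, hence the detour through the preimage \<open>U\<close> of the
    stratum.\<close>
  define U where "U = {y \<in> orthant n. q y \<in> q ` ?C}"
  have U: "?C \<subseteq> U" "U \<subseteq> orthant n"
    using cell_subset by (auto simp: U_def)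
  have "?C = X closure_of ?C \<inter> U"
  proof
    show "?C \<subseteq> X closure_of ?C \<inter> U"
      using U(1) closure_of_subset[of ?C X] cell_subset by simp
    show "X closure_of ?C \<inter> U \<subseteq> ?C"
    proof
      fix y assume "y \<in> X closure_of ?C \<inter> U"
      then obtain z where y: "y \<in> orthant n" "pattern n x \<subseteq> pattern n y" "z \<in> ?C" "q y = q z"
        by (auto simp: closure_of_cell[OF x] U_def)
      then have "card (pattern n y) = card (pattern n x)"
        using card_pattern_q[of y z] by (simp add: cell_def)
      then have "pattern n x = pattern n y"
        using y(2) by (intro card_seteq finite_pattern) simp_all
      then show "y \<in> ?C"
        using y(1) by (simp add: cell_def)
    qed
  qed
  then have closed: "closedin (subtopology X U) ?C"
    by (metis closedin_closure_of closedin_subtopology)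
  have "closed_map (subtopology X U) (subtopology Y (q ` ?C)) q"
    using closed_map_q by (rule closed_map_restriction) (simp add: U_def)
  then have "closed_map (subtopology (subtopology X U) ?C) (subtopology Y (q ` ?C)) q"
    using closed by (rule closed_map_from_subtopology)
  moreover have top: "subtopology (subtopology X U) ?C = top_of_set ?C" "subtopology X ?C = top_of_set ?C"
    using U by (simp_all add: subtopology_subtopology Int_absorb1 Int_absorb2 inf.absorb2)
  moreover have "continuous_map (subtopology X ?C) (subtopology Y (q ` ?C)) q"
    using continuous_map_from_subtopology[OF continuous_map_q]
    by (auto simp: continuous_map_in_subtopology)
  moreover have "topspace (subtopology Y (q ` ?C)) = q ` ?C"
    using cell_subset by (auto simp: topspace_Y)
  ultimately show ?thesis
    using inj_on_q_cell by (intro bijective_closed_imp_homeomorphic_map) simp_all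
qed

lemma topological_manifold_stratum:
  assumes x: "x \<in> orthant n"
  shows "\<exists>k. topological_manifold k (subtopology Y (q ` cell n x))"
proof -
  let ?S = "subtopology Y (q ` cell n x)"
  obtain k V where V: "openin (Euclidean_space k) V"
    "top_of_set (cell n x) homeomorphic_space subtopology (Euclidean_space k) V"
    using cell_homeomorphic_open[OF x] .
  have "?S homeomorphic_space subtopology (Euclidean_space k) V"
    using homeomorphic_map_imp_homeomorphic_space[OF homeomorphic_map_q_cell[OF x]] V(2)
    by (meson homeomorphic_space_sym homeomorphic_space_trans)
  \<comment> \<open>A single chart suffices: the whole stratum is homeomorphic to
    \<open>V\<close>.\<close>
  then have "topological_manifold k ?S"
    unfolding topological_manifold_def
    using V(1) Hausdorff_space_subtopology[OF Hausdorff_space_Y]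
      second_countable_subtopology[OF second_countable_Y]
    by (metis openin_topspace subtopology_topspace)
  then show ?thesis ..
qed

text \<open>If \<open>g\<close> moves one point of the cell of \<open>x\<close> into the closure of
  the cell of \<open>y\<close>, it moves the whole cell there: all images have the same pattern, and
  membership in that closure depends only on the pattern.\<close>

lemma frontier_condition:
  assumes x: "x \<in> orthant n" and y: "y \<in> orthant n"
    and meet: "q ` cell n x \<inter> Y closure_of (q ` cell n y) \<noteq> {}"
  shows "q ` cell n x \<subseteq> Y closure_of (q ` cell n y)"
proof -
  have cl: "Y closure_of (q ` cell n y) = q ` {w \<in> orthant n. pattern n y \<subseteq> pattern n w}"
    by (simp add: closure_of_image_q[OF cell_subset] closure_of_cell[OF y])
  obtain z w where z: "z \<in> cell n x" and w: "w \<in> orthant n" "pattern n y \<subseteq> pattern n w"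
    and "q z = q w"
    using meet unfolding cl by blast
  then obtain g where g: "g \<in> carrier G" "w = \<phi> g z"
    using q_eq_iff cell_subset by blast
  show ?thesis
    unfolding cl
  proof clarify
    fix v assume "v \<in> cell n x"
    then have v: "v \<in> orthant n" "pattern n v = pattern n z" "z \<in> orthant n"
      using z by (auto simp: cell_def)
    have "\<phi> g v \<in> {w \<in> orthant n. pattern n y \<subseteq> pattern n w}"
      using element_image[OF g(1) v(1)] pattern_action_cong[OF g(1) v(1,3,2)] w g(2) by simp
    then show "q v \<in> q ` {w \<in> orthant n. pattern n y \<subseteq> pattern n w}"
      by (rule image_eqI[where f = q, OF q_action[OF g(1) v(1), symmetric]])
  qed
qed

theorem stratified_space_quotient: "stratified_space (quotient_topology (orthant_topology n) q)"
proof -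
  have "locally_finite_in Y strata"
    using finite_strata partition_on_strata
    by (intro finite_imp_locally_finite_in) (auto simp: partition_on_def)
  then have "stratification Y strata"
    unfolding stratification_def
    using partition_on_strata locally_closed_stratum topological_manifold_stratum frontier_condition
    by (auto simp: strata_def)
  then show ?thesis
    unfolding stratified_space_def orthant_topology_eq_top_of_set
    using Hausdorff_space_Y second_countable_Y by blast
qed

end

section \<open>The action on edge weights\<close>

text \<open>Unordered endpoints let a vertex permutation act by taking images, without sorting the
  pair again.\<close>

definition edge_set :: "nat \<Rightarrow> nat \<Rightarrow> nat set" where
  "edge_set d k = {fst (edge_list d ! k), snd (edge_list d ! k)}"

lemma bij_betw_edge_set:
  "bij_betw (edge_set d) {..<d choose 2} {{i, j} | i j. i \<in> {1..d} \<and> j \<in> {1..d} \<and> i \<noteq> j}"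
  unfolding bij_betw_def
proof
  show "inj_on (edge_set d) {..<d choose 2}"
  proof (rule inj_onI)
    fix k l assume k: "k \<in> {..<d choose 2}" and l: "l \<in> {..<d choose 2}"
      and eq: "edge_set d k = edge_set d l"
    obtain i j i' j' where ij: "edge_list d ! k = (i, j)" "edge_list d ! l = (i', j')"
      by fastforce
    then have "i < j" "i' < j'"
      using edge_list_nth k l by blast+
    then have "(i, j) = (i', j')"
      using eq ij by (auto simp: edge_set_def doubleton_eq_iff)
    then show "k = l"
      using ij k l nth_eq_iff_index_eq[OF distinct_edge_list, of k d l] by (simp add: length_edge_list)
  qed
  show "edge_set d ` {..<d choose 2} = {{i, j} | i j. i \<in> {1..d} \<and> j \<in> {1..d} \<and> i \<noteq> j}"
  proof
    show "edge_set d ` {..<d choose 2} \<subseteq> {{i, j} | i j. i \<in> {1..d} \<and> j \<in> {1..d} \<and> i \<noteq> j}"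
    proof clarify
      fix k assume k: "k < d choose 2"
      obtain i j where ij: "edge_list d ! k = (i, j)"
        by fastforce
      show "\<exists>i j. edge_set d k = {i, j} \<and> i \<in> {1..d} \<and> j \<in> {1..d} \<and> i \<noteq> j"
        using edge_list_nth[OF k ij] ij by (intro exI[of _ i] exI[of _ j]) (auto simp: edge_set_def)
    qed
    have "{i, j} \<in> edge_set d ` {..<d choose 2}" if "1 \<le> i" "i < j" "j \<le> d" for i j
      using edge_list_nth_exists[OF that] by (force simp: edge_set_def)
    then show "{{i, j} | i j. i \<in> {1..d} \<and> j \<in> {1..d} \<and> i \<noteq> j} \<subseteq> edge_set d ` {..<d choose 2}"
      by (smt (verit) Collect_mono_iff atLeastAtMost_iff insert_commute linorder_neq_iff mem_Collect_eq subsetI)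
  qed
qed

text \<open>Symmetry of \<open>w\<close> allows the endpoints to be named in either order.\<close>

lemma edge_weights_edge_set:
  assumes "w \<in> networks d" "k < d choose 2" "edge_set d k = {i, j}"
  shows "edge_weights d w k = w i j"
proof -
  have "w i j = w j i"
    using assms(1) unfolding networks_def by blast
  then show ?thesis
    using assms by (auto simp: edge_weights_def edge_set_def doubleton_eq_iff split: prod.split)
qed

lemma edge_action_permutes:
  assumes "\<sigma> \<in> carrier (sym_group d)"
  shows "\<exists>\<pi>. \<pi> permutes {..<d choose 2} \<and> (\<forall>x \<in> orthant (d choose 2). edge_action d \<sigma> x = x \<circ> \<pi>)"
proof -
  define \<tau> where "\<tau> = inv' \<sigma>"
  define D where "D = d choose 2"
  define S where "S = {{i, j} | i j. i \<in> {1..d} \<and> j \<in> {1..d} \<and> i \<noteq> j}"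
  have \<tau>: "\<tau> permutes {1..d}"
    using assms by (simp add: \<tau>_def sym_group_carrier permutes_inv)
  have mapsto: "\<rho> ` e \<in> S" if "\<rho> permutes {1..d}" "e \<in> S" for \<rho> e
  proof -
    obtain i j where "e = {i, j}" "i \<in> {1..d}" "j \<in> {1..d}" "i \<noteq> j"
      using \<open>e \<in> S\<close> unfolding S_def by blast
    moreover have "\<rho> i \<noteq> \<rho> j"
      using calculation permutes_inj[OF that(1)] by (simp add: inj_eq)
    ultimately show ?thesis
      using permutes_in_image[OF that(1)] unfolding S_def by blast
  qed
  have bij_S: "bij_betw ((`) \<tau>) S S"
    using mapsto[OF \<tau>] mapsto[OF permutes_inv[OF \<tau>]] permutes_inv_o[OF \<tau>]
    by (intro bij_betw_byWitness[where f' = "(`) (inv' \<tau>)"]) (auto simp: image_comp)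
  define e where "e = edge_set d"
  have e: "bij_betw e {..<D} S"
    using bij_betw_edge_set by (simp add: e_def D_def S_def)
  \<comment> \<open>\<open>p k\<close> is the index of the edge to which \<open>\<tau>\<close> takes
    edge number \<open>k\<close>; \<open>\<tau>\<close> is the inverse of \<open>\<sigma>\<close>
    because the action on networks composes weights with that inverse.\<close>
  define p where "p = inv_into {..<D} e \<circ> ((`) \<tau> \<circ> e)"
  have p: "bij_betw p {..<D} {..<D}"
    unfolding p_def
    by (rule bij_betw_trans[OF bij_betw_trans[OF e bij_S] bij_betw_inv_into[OF e]])
  have e_p: "e (p k) = \<tau> ` e k" if "k < D" for k
  proof -
    have "\<tau> ` e k \<in> e ` {..<D}"
      using bij_betwE[OF e] bij_betwE[OF bij_S] bij_betw_imp_surj_on[OF e] that by auto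
    then show ?thesis
      by (simp add: p_def f_inv_into_f)
  qed
  \<comment> \<open>Being the identity from \<open>D\<close> on makes \<open>\<pi>\<close> a
    permutation of all indices and keeps the vanishing coordinates in place.\<close>
  define \<pi> where "\<pi> k = (if k < D then p k else k)" for k
  have "bij_betw \<pi> {..<D} {..<D}"
    using p by (subst bij_betw_cong[of _ _ p]) (auto simp: \<pi>_def)
  then have "\<pi> permutes {..<D}"
    by (rule bij_imp_permutes) (simp add: \<pi>_def)
  moreover have "edge_action d \<sigma> x = x \<circ> \<pi>" if x: "x \<in> orthant D" for x
  proof -
    obtain w where w: "w \<in> networks d" "x = edge_weights d w"
      using x bij_betw_imp_surj_on[OF bij_betw_edge_weights] unfolding D_def by blast
    have "edge_weights d (network_action d \<sigma> w) k = edge_weights d w (\<pi> k)" for k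
    proof (cases "k < D")
      case True
      then obtain i j where ij: "e k = {i, j}"
        by (auto simp: e_def edge_set_def)
      have "p k < D"
        using bij_betwE[OF p] True by simp
      then have "edge_weights d w (p k) = w (\<tau> i) (\<tau> j)"
        using w(1) e_p[OF True] ij by (intro edge_weights_edge_set) (auto simp: e_def D_def)
      moreover have "edge_weights d (network_action d \<sigma> w) k = network_action d \<sigma> w i j"
        using network_action_closed[OF assms w(1)] True ij
        by (intro edge_weights_edge_set) (auto simp: e_def D_def)
      ultimately show ?thesis
        using w(1) True by (simp add: network_action_def \<tau>_def \<pi>_def)
    qed (simp add: edge_weights_def \<pi>_def D_def)
    then show ?thesis
      unfolding w(2) edge_action_edge_weights[OF w(1)] by (simp add: fun_eq_iff)
  qed
  ultimately show ?thesis
    unfolding D_def by blast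
qed

theorem theorem2p4:
  fixes d :: nat
  assumes "d \<ge> 2"
  shows "stratified_space (unlabeled_networks d)"
proof -
  have "finite (carrier (sym_group d))"
    by (simp add: sym_group_def finite_permutations)
  then interpret orthant_permutation_action "sym_group d" "d choose 2" "edge_action d"
    using group_action_orthant edge_action_permutes
    by (intro orthant_permutation_action.intro orthant_permutation_action_axioms.intro)
  show ?thesis
    unfolding unlabeled_networks_def by (rule stratified_space_quotient)
qed

end
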